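(* Let $x=(x_1,x_2)$, $\Delta=(2,1)$, $\delta=(1,0)$. For every partition $\lambda=(\lambda_1,\lambda_2)\in\mathscr P^{(2)}$, the following equalities hold: \begin{align*} Q_{2\lambda+2\Delta}(x,x) &=4\sum_{\sigma_1,\sigma_2\in\mathfrak S_2}\mathrm{sgn}(\sigma_1)\,\mathrm{sgn}(\sigma_2)\sum_{(u,v)\in B(\lambda;\sigma_1,\sigma_2)}q_{2u_1}(x)\,q_{2u_2+1}(x)\,q_{2v_1}(x)\,q_{2v_2+1}(x),\\ Q_{2\lambda+\Delta+\delta}(x,x) &=4\sum_{\sigma_1,\sigma_2\in\mathfrak S_2}\mathrm{sgn}(\sigma_1)\,\mathrm{sgn}(\sigma_2)\sum_{(u,v)\in B(\lambda;\sigma_1,\sigma_2)}q_{2u_1}(x)\,q_{2u_2+1}(x)\,q_{2v_1-1}(x)\,q_{2v_2}(x). \end{align*} Here, for $\sigma_1,\sigma_2\in\mathfrak S_2$, $B(\lambda;\sigma_1,\sigma_2)$ denotes the set of all $(u,v)=((u_1,u_2),(v_1,v_2))\in(\mathbb Z_{\ge0})^2\times(\mathbb Z_{\ge0})^2$ satisfying $u_1+u_2+v_1+v_2=\lambda_1+\lambda_2+2$ and $u_{\sigma_1(2)}+v_{\sigma_2(2)}\le\lambda_2$.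
   Context: $\mathscr P^{(2)}$ is the set of partitions of length at most $2$, written as pairs $(\lambda_1,\lambda_2)$ of integers with $\lambda_1\ge\lambda_2\ge0$. Sums and multiples are componentwise, so $2\lambda+2\Delta=(2\lambda_1+4,2\lambda_2+2)$ and $2\lambda+\Delta+\delta=(2\lambda_1+3,2\lambda_2+1)$. $\mathfrak S_2$ is the symmetric group on $\{1,2\}$ and $\mathrm{sgn}$ is the sign of a permutation. The polynomials $q_r(x)$, $r\ge 0$, are defined by $\sum_{r\ge0}q_r(x)t^r=\prod_{i=1}^2\frac{1+x_it}{1-x_it}$, and $q_r(x)=0$ for $r<0$. The polynomials $q_r(x,x)$ are defined by $\sum_{r\ge0}q_r(x,x)t^r=\prod_{i=1}^2\left(\frac{1+x_it}{1-x_it}\right)^2$. For $r,s\ge0$ with $(r,s)\ne(0,0)$, $$Q_{(r,s)}(x,x)=q_r(x,x)q_s(x,x)+2\sum_{i=1}^s(-1)^iq_{r+i}(x,x)q_{s-i}(x,x).$$ *)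

theory Defs
  imports
    "HOL-Computational_Algebra.Computational_Algebra"
    "HOL-Combinatorics.Permutations"
    "HOL-Library.Product_Plus"
begin

text \<open>Elements of \<^typ>\<open>'a poly poly\<close> are polynomials in two variables over the
  commutative ring \<^typ>\<open>'a\<close>: the outer variable is $x_2$, and $x_1$ is the variable
  of the coefficient ring. Values at indices other than 1 and 2 are never used.\<close>

definition indet :: "nat \<Rightarrow> 'a::comm_ring_1 poly poly" where
  "indet i = (if i = 1 then [:[:0, 1:]:] else [:0, 1:])"

text \<open>The factor $(1 + at)/(1 - at)$ as a formal power series in $t$. A polynomial ring is
  not in the class \<^class>\<open>inverse\<close>, so the reciprocal is taken with
  \<open>fps_right_inverse\<close>, whose second argument is the inverse of the constant term.\<close>

definition q_factor :: "'a::comm_ring_1 \<Rightarrow> 'a fps" where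
  "q_factor a =
     (1 + fps_const a * fps_X) * fps_right_inverse (1 - fps_const a * fps_X) 1"

lemma q_factor_mult: "q_factor a * (1 - fps_const a * fps_X) = 1 + fps_const a * fps_X"
proof -
  have "(1 - fps_const a * fps_X) * fps_right_inverse (1 - fps_const a * fps_X) 1 = 1"
    by (rule fps_right_inverse) simp
  then show ?thesis
    unfolding q_factor_def by (metis mult.assoc mult.commute mult.right_neutral)
qed

definition q :: "(nat \<Rightarrow> 'a::comm_ring_1) \<Rightarrow> int \<Rightarrow> 'a" where
  "q x r = (if r < 0 then 0 else fps_nth (\<Prod>i\<in>{1,2}. q_factor (x i)) (nat r))"

text \<open>\<open>q2 x r\<close> is $q_r(x,x)$ and \<open>Q2 x (r, s)\<close> is $Q_{(r,s)}(x,x)$, which is only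
  meaningful for \<open>(r, s) \<noteq> (0, 0)\<close>.\<close>

definition q2 :: "(nat \<Rightarrow> 'a::comm_ring_1) \<Rightarrow> nat \<Rightarrow> 'a" where
  "q2 x r = fps_nth (\<Prod>i\<in>{1,2}. (q_factor (x i))\<^sup>2) r"

definition Q2 :: "(nat \<Rightarrow> 'a::comm_ring_1) \<Rightarrow> nat \<times> nat \<Rightarrow> 'a" where
  "Q2 x = (\<lambda>(r, s). q2 x r * q2 x s + 2 * (\<Sum>i=1..s. (-1) ^ i * q2 x (r + i) * q2 x (s - i)))"

definition partitions2 :: "(nat \<times> nat) set" where
  "partitions2 = {(l1, l2). l1 \<ge> l2}"

definition scale :: "nat \<Rightarrow> nat \<times> nat \<Rightarrow> nat \<times> nat" where
  "scale n p = (n * fst p, n * snd p)"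

definition Delta :: "nat \<times> nat" where "Delta = (2, 1)"

definition delta :: "nat \<times> nat" where "delta = (1, 0)"

definition S2 :: "(nat \<Rightarrow> nat) set" where
  "S2 = {\<sigma>. \<sigma> permutes {1, 2}}"

text \<open>\<open>entry u i\<close> is $u_i$, for $i = 1, 2$.\<close>

definition entry :: "nat \<times> nat \<Rightarrow> nat \<Rightarrow> nat" where
  "entry u i = (if i = 1 then fst u else snd u)"

definition B :: "nat \<times> nat \<Rightarrow> (nat \<Rightarrow> nat) \<Rightarrow> (nat \<Rightarrow> nat) \<Rightarrow> ((nat \<times> nat) \<times> (nat \<times> nat)) set" where
  "B lam \<sigma>1 \<sigma>2 =
     {(u, v). entry u 1 + entry u 2 + entry v 1 + entry v 2 = entry lam 1 + entry lam 2 + 2 \<and>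
              entry u (\<sigma>1 2) + entry v (\<sigma>2 2) \<le> entry lam 2}"

text \<open>The sums over \<^const>\<open>B\<close> below are genuine: the index set is finite.\<close>

lemma finite_B: "finite (B lam \<sigma>1 \<sigma>2)"
proof (rule finite_subset)
  let ?N = "{..entry lam 1 + entry lam 2 + 2}"
  show "B lam \<sigma>1 \<sigma>2 \<subseteq> (?N \<times> ?N) \<times> (?N \<times> ?N)"
    by (auto simp: B_def entry_def)
qed simp

end

theory Submission
  imports Defs
begin

text \<open>
  Let $F(t) = \sum_r q_r t^r = \prod_i (1 + x_i t)/(1 - x_i t)$ and separate parities,
  $F(t) = E(t^2) + t\,O(t^2)$. Replacing $t$ by $-t$ inverts every factor, so
  $F(t) F(-t) = 1$, that is, $E(T)^2 = 1 + T\,O(T)^2$ (lemma \<open>even_part_square_eq\<close>).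
  On coefficients this says that $E^2$ has constant term $1$ and is, beyond that, $O^2$ shifted by
  one place. As $\sum_r q_r(x,x) t^r = F(t)^2$, every $q_r(x,x)$ with $r > 0$ is then twice one
  coefficient of $O^2$ ($r$ even) or of $E O$ ($r$ odd). Hence $Q_{(r,s)}(x,x)$, with its sum
  split according to the parity of the index, is a combination of the truncated convolutions
  $\sum_{j \le n} [T^{m-j}]G \cdot [T^j]H$ with $G$ and $H$ among $E^2$, $O^2$ and $E O$
  (lemmas \<open>Q2_even_even\<close> and \<open>Q2_odd_odd\<close>).

  The right-hand sides have the same shape. In the sum over $B(\lambda;\sigma_1,\sigma_2)$,
  the indices $u_{\sigma_1(2)}$ and $v_{\sigma_2(2)}$ have some sum $j \le \lambda_2$ and the other
  two indices have sum $\lambda_1 + \lambda_2 + 2 - j$, so for each $j$ the sum factors into two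
  coefficients of products of $E$ and $O$ (lemma \<open>signed_sum_B\<close>). The index $2 v_1 - 1$ of the
  second identity amounts to $T\,O$ in place of $O$. The choices of $(\sigma_1,\sigma_2)$ with
  sign $+1$ and those with sign $-1$ give exactly the two parity classes of the sum that
  defines $Q$.

  It remains to match boundary terms. In the first identity $E^2 = 1 + T\,O^2$ turns the
  convolutions for the pairs $(E^2, O^2)$ and $(O^2, E^2)$ into one common sum plus a boundary term
  each. One of these terms supplies the product $q_r(x,x) q_s(x,x)$, which $Q_{(r,s)}$ contains
  once rather than twice, and the other one the term with $q_0(x,x) = 1$. In the second identity
  the two convolutions of $E O$ supply the product in this way, and those of $E^2$ and $O^2$ the term
  with $q_0(x,x)$.
\<close>

section \<open>Even and odd parts of a power series\<close>

definition even_part :: "'a::comm_ring_1 fps \<Rightarrow> 'a fps" where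
  "even_part f = Abs_fps (\<lambda>k. fps_nth f (2 * k))"

definition odd_part :: "'a::comm_ring_1 fps \<Rightarrow> 'a fps" where
  "odd_part f = Abs_fps (\<lambda>k. fps_nth f (2 * k + 1))"

text \<open>The series $f(-t)$. On coefficients its multiplicativity is the identity
  $(-1)^n = (-1)^i (-1)^{n-i}$, valid over every commutative ring.\<close>

definition alternate :: "'a::comm_ring_1 fps \<Rightarrow> 'a fps" where
  "alternate f = Abs_fps (\<lambda>n. (-1) ^ n * fps_nth f n)"

lemma even_part_nth [simp]: "fps_nth (even_part f) k = fps_nth f (2 * k)"
  by (simp add: even_part_def)

lemma odd_part_nth [simp]: "fps_nth (odd_part f) k = fps_nth f (Suc (2 * k))"
  by (simp add: odd_part_def)

lemma alternate_nth [simp]: "fps_nth (alternate f) n = (-1) ^ n * fps_nth f n"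
  by (simp add: alternate_def)

lemma sum_lessThan_double:
  fixes g :: "nat \<Rightarrow> 'a::comm_monoid_add"
  shows "(\<Sum>i<2 * n. g i) = (\<Sum>k<n. g (2 * k)) + (\<Sum>k<n. g (Suc (2 * k)))"
  by (induction n) (simp_all add: ac_simps)

lemma fps_mult_nth_lessThan:
  "fps_nth (f * g) n = (\<Sum>i<Suc n. fps_nth f i * fps_nth g (n - i))"
  by (simp only: fps_mult_nth lessThan_Suc_atMost atLeast0AtMost)

text \<open>If $f = f_0(t^2) + t f_1(t^2)$ and $g = g_0(t^2) + t g_1(t^2)$, then
  $f g = (f_0 g_0 + t^2 f_1 g_1)(t^2) + t (f_0 g_1 + f_1 g_0)(t^2)$. Read coefficientwise, this is
  the present lemma and the next one.\<close>

lemma mult_nth_even: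
  "fps_nth (f * g) (2 * k) =
     fps_nth (even_part f * even_part g + fps_X * (odd_part f * odd_part g)) k"
proof -
  have odd: "(\<Sum>i<k. fps_nth f (Suc (2 * i)) * fps_nth g (2 * k - Suc (2 * i)))
      = fps_nth (fps_X * (odd_part f * odd_part g)) k"
  proof (cases k)
    case (Suc l)
    have "Suc (2 * l) - 2 * i = Suc (2 * (l - i))" if "i \<le> l" for i
      using that by simp
    then show ?thesis
      unfolding Suc fps_X_mult_nth
      by (simp add: fps_mult_nth_lessThan del: sum.lessThan_Suc)
  qed simp
  have "(\<Sum>i<Suc k. fps_nth f (2 * i) * fps_nth g (2 * k - 2 * i))
      = fps_nth (even_part f * even_part g) k"
    by (simp add: fps_mult_nth_lessThan right_diff_distrib' del: sum.lessThan_Suc)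
  then have even: "(\<Sum>i<k. fps_nth f (2 * i) * fps_nth g (2 * k - 2 * i)) + fps_nth f (2 * k) * fps_nth g 0
      = fps_nth (even_part f * even_part g) k"
    by simp
  have "fps_nth (f * g) (2 * k)
      = (\<Sum>i<2 * k. fps_nth f i * fps_nth g (2 * k - i)) + fps_nth f (2 * k) * fps_nth g 0"
    by (simp add: fps_mult_nth_lessThan)
  then show ?thesis
    unfolding sum_lessThan_double odd fps_add_nth even[symmetric] by (simp only: ac_simps)
qed

lemma mult_nth_odd:
  "fps_nth (f * g) (Suc (2 * k)) =
     fps_nth (even_part f * odd_part g + odd_part f * even_part g) k"
proof -
  have *: "Suc (2 * k) - 2 * i = Suc (2 * (k - i))" if "i \<le> k" for i
    using that by simp
  have "fps_nth (f * g) (Suc (2 * k))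
      = (\<Sum>i<2 * Suc k. fps_nth f i * fps_nth g (Suc (2 * k) - i))"
    by (simp add: fps_mult_nth_lessThan)
  also have "\<dots> = (\<Sum>i<Suc k. fps_nth f (2 * i) * fps_nth g (Suc (2 * (k - i))))
      + (\<Sum>i<Suc k. fps_nth f (Suc (2 * i)) * fps_nth g (2 * (k - i)))"
    unfolding sum_lessThan_double
    by (intro arg_cong2[where f = "(+)"] sum.cong) (simp_all add: * right_diff_distrib')
  finally show ?thesis
    by (simp add: fps_mult_nth_lessThan del: sum.lessThan_Suc)
qed

lemma even_part_alternate [simp]: "even_part (alternate f) = even_part f"
  by (simp add: fps_eq_iff)

lemma odd_part_alternate [simp]: "odd_part (alternate f) = - odd_part f"
  by (simp add: fps_eq_iff)

lemma alternate_mult: "alternate (f * g) = alternate f * alternate g"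
proof (rule fps_ext)
  fix n
  have "(-1) ^ n * (a * b) = ((-1) ^ i * a) * ((-1) ^ (n - i) * (b::'a))" if "i \<le> n" for i a b
  proof -
    have "(-1) ^ n = (-1) ^ i * (-1::'a) ^ (n - i)"
      using that by (simp flip: power_add)
    then show ?thesis by (simp add: ac_simps)
  qed
  then show "fps_nth (alternate (f * g)) n = fps_nth (alternate f * alternate g) n"
    by (auto simp: fps_mult_nth sum_distrib_left intro!: sum.cong)
qed

text \<open>With $f = E(t^2) + t\,O(t^2)$ the hypothesis reads $E(t^2)^2 - t^2 O(t^2)^2 = 1$.\<close>

lemma even_part_square_eq:
  assumes "f * alternate f = 1"
  shows "even_part f * even_part f = 1 + fps_X * (odd_part f * odd_part f)"
proof (rule fps_ext)
  fix k
  have "fps_nth (1 :: 'a fps) (2 * k) = fps_nth (1 :: 'a fps) k"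
    by simp
  moreover have "fps_nth (f * alternate f) (2 * k)
      = fps_nth (even_part f * even_part f) k - fps_nth (fps_X * (odd_part f * odd_part f)) k"
    by (subst mult_nth_even) simp
  ultimately show "fps_nth (even_part f * even_part f) k
      = fps_nth (1 + fps_X * (odd_part f * odd_part f)) k"
    by (simp only: assms fps_add_nth) (simp add: algebra_simps)
qed

section \<open>The generating functions of q\<close>

definition q_series :: "(nat \<Rightarrow> 'a::comm_ring_1) \<Rightarrow> 'a fps" where
  "q_series x = (\<Prod>i\<in>{1,2}. q_factor (x i))"

text \<open>Replacing $t$ by $-t$ in $(1 + at)/(1 - at)$ exchanges numerator and denominator.\<close>

lemma q_factor_alternate: "q_factor a * alternate (q_factor a) = 1"
proof -
  let ?m = "1 - fps_const a * fps_X" and ?p = "1 + fps_const a * fps_X"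
  have m: "?m * fps_right_inverse ?m 1 = 1"
    by (rule fps_right_inverse) simp
  have alt_m: "alternate ?m = ?p"
    by (auto simp: fps_eq_iff fps_X_def)
  have alt_p: "alternate ?p = ?m"
    by (auto simp: fps_eq_iff fps_X_def)
  have "?p * alternate (fps_right_inverse ?m 1) = alternate 1"
    unfolding alt_m[symmetric] alternate_mult[symmetric] m ..
  also have "alternate 1 = (1 :: 'a fps)"
    by (auto simp: fps_eq_iff)
  finally have p: "?p * alternate (fps_right_inverse ?m 1) = 1" .
  have "q_factor a * alternate (q_factor a)
      = (?m * fps_right_inverse ?m 1) * (?p * alternate (fps_right_inverse ?m 1))"
    unfolding q_factor_def alternate_mult alt_p by (simp only: ac_simps)
  then show ?thesis
    by (simp only: m p mult_1_left)
qed

lemma q_series_alternate: "q_series x * alternate (q_series x) = 1"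
proof -
  have "q_series x * alternate (q_series x) =
     (q_factor (x 1) * alternate (q_factor (x 1))) * (q_factor (x 2) * alternate (q_factor (x 2)))"
    by (simp add: q_series_def alternate_mult ac_simps)
  then show ?thesis
    by (simp add: q_factor_alternate)
qed

abbreviation q_ee :: "(nat \<Rightarrow> 'a::comm_ring_1) \<Rightarrow> nat \<Rightarrow> 'a" where
  "q_ee x \<equiv> fps_nth (even_part (q_series x) * even_part (q_series x))"

abbreviation q_oo :: "(nat \<Rightarrow> 'a::comm_ring_1) \<Rightarrow> nat \<Rightarrow> 'a" where
  "q_oo x \<equiv> fps_nth (odd_part (q_series x) * odd_part (q_series x))"

abbreviation q_eo :: "(nat \<Rightarrow> 'a::comm_ring_1) \<Rightarrow> nat \<Rightarrow> 'a" where
  "q_eo x \<equiv> fps_nth (even_part (q_series x) * odd_part (q_series x))"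

text \<open>The relation $E^2 = 1 + T\,O^2$ on coefficients. It lets every coefficient of $E^2$ with
  positive index be exchanged for one of $O^2$.\<close>

lemma q_ee_0: "q_ee x 0 = 1"
  and q_ee_Suc: "q_ee x (Suc k) = q_oo x k"
  by (simp_all only: even_part_square_eq[OF q_series_alternate]) simp_all

lemma q2_eq: "q2 x r = fps_nth (q_series x * q_series x) r"
  by (simp add: q2_def q_series_def power2_eq_square ac_simps)

lemma q2_0: "q2 x 0 = 1"
  using mult_nth_even[of "q_series x" "q_series x" 0] q_ee_0[of x]
  by (simp add: q2_eq)

text \<open>The even part of $F^2$ is $E^2 + T\,O^2$, whose two summands agree except in the constant
  term.\<close>

lemma q2_even: "q2 x (Suc (Suc (2 * k))) = 2 * q_oo x k"
proof -
  have "q2 x (2 * Suc k) = q_ee x (Suc k) + q_oo x k"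
    unfolding q2_eq mult_nth_even by simp
  also have "\<dots> = 2 * q_oo x k"
    by (simp only: q_ee_Suc mult_2)
  finally show ?thesis by simp
qed

lemma q2_odd: "q2 x (Suc (2 * k)) = 2 * q_eo x k"
  unfolding q2_eq mult_nth_odd fps_add_nth
  by (simp only: mult.commute[of "odd_part (q_series x)"] mult_2)

lemma q_even: "q x (2 * int k) = fps_nth (even_part (q_series x)) k"
  by (simp add: q_def q_series_def nat_mult_distrib)

lemma q_odd: "q x (2 * int k + 1) = fps_nth (odd_part (q_series x)) k"
  by (simp add: q_def q_series_def nat_add_distrib nat_mult_distrib)

text \<open>Multiplication by the indeterminate also covers $k = 0$, where the index is $-1$ and both
  sides vanish.\<close>

lemma q_odd_shifted: "q x (2 * int k - 1) = fps_nth (fps_X * odd_part (q_series x)) k"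
proof (cases k)
  case (Suc l)
  have "2 * int k - 1 = 2 * int l + 1"
    by (simp add: Suc)
  then show ?thesis
    by (simp only: q_odd) (simp add: Suc)
qed (simp add: q_def)

section \<open>Signed sums over quadruples of indices\<close>

lemma S2_eq: "S2 = {id, transpose 1 2}"
  by (auto simp: S2_def permutes_doubleton_iff)

text \<open>The set \<open>B\<close> for trivial permutations; the other three cases are obtained from it by
  exchanging the entries of $u$ or of $v$.\<close>

definition quads :: "nat \<Rightarrow> nat \<Rightarrow> ((nat \<times> nat) \<times> (nat \<times> nat)) set" where
  "quads m n = {((a, b), (c, d)). a + b + c + d = m \<and> b + d \<le> n}"

text \<open>Group the quadruples by $j = b + d$. Then $a + c = m - j$, and for fixed $j$ the pairs
  $(a, c)$ and $(b, d)$ vary independently.\<close>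

lemma sum_quads:
  fixes f g h k :: "'a::comm_ring_1 fps"
  assumes "n \<le> m"
  shows "(\<Sum>((a, b), (c, d))\<in>quads m n.
            fps_nth f a * fps_nth g b * fps_nth h c * fps_nth k d)
       = (\<Sum>j\<le>n. fps_nth (f * h) (m - j) * fps_nth (g * k) j)"
proof -
  have "(\<Sum>j\<le>n. fps_nth (f * h) (m - j) * fps_nth (g * k) j)
      = (\<Sum>j\<le>n. \<Sum>(a, b)\<in>{0..m - j} \<times> {0..j}.
           fps_nth f a * fps_nth h (m - j - a) * (fps_nth g b * fps_nth k (j - b)))"
    by (simp only: fps_mult_nth sum_product sum.cartesian_product)
  also have "\<dots> = (\<Sum>(j, a, b)\<in>(SIGMA j:{..n}. {0..m - j} \<times> {0..j}).
           fps_nth f a * fps_nth h (m - j - a) * (fps_nth g b * fps_nth k (j - b)))"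
    by (subst sum.Sigma) (simp_all add: split_def)
  also have "\<dots> = (\<Sum>((a, b), (c, d))\<in>quads m n.
            fps_nth f a * fps_nth g b * fps_nth h c * fps_nth k d)"
    by (rule sum.reindex_bij_witness[where
          i = "\<lambda>((a, b), (c, d)). (b + d, a, b)" and
          j = "\<lambda>(j, a, b). ((a, b), (m - j - a, j - b))"])
       (use assms in \<open>auto simp: quads_def ac_simps\<close>)
  finally show ?thesis by simp
qed

text \<open>A nontrivial $\sigma_1$ exchanges the roles of $f$ and $g$, and a nontrivial $\sigma_2$
  those of $h$ and $k$.\<close>

lemma signed_sum_B:
  fixes f g h k :: "'a::comm_ring_1 fps"
  defines "w \<equiv> \<lambda>u v. fps_nth f (entry u 1) * fps_nth g (entry u 2) *
                       fps_nth h (entry v 1) * fps_nth k (entry v 2)"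
  shows "(\<Sum>\<sigma>1\<in>S2. \<Sum>\<sigma>2\<in>S2. of_int (sign \<sigma>1) * of_int (sign \<sigma>2) *
            (\<Sum>(u, v)\<in>B (l1, l2) \<sigma>1 \<sigma>2. w u v))
       = (\<Sum>j\<le>l2. fps_nth (f * h) (l1 + l2 + 2 - j) * fps_nth (g * k) j)
       + (\<Sum>j\<le>l2. fps_nth (g * k) (l1 + l2 + 2 - j) * fps_nth (f * h) j)
       - (\<Sum>j\<le>l2. fps_nth (g * h) (l1 + l2 + 2 - j) * fps_nth (f * k) j)
       - (\<Sum>j\<le>l2. fps_nth (f * k) (l1 + l2 + 2 - j) * fps_nth (g * h) j)"
proof -
  let ?m = "l1 + l2 + 2" and ?t = "transpose (1::nat) 2"
  have le: "l2 \<le> ?m" by simp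
  have B: "(\<Sum>(u, v)\<in>B (l1, l2) id id. w u v)
      = (\<Sum>j\<le>l2. fps_nth (f * h) (?m - j) * fps_nth (g * k) j)"
    unfolding sum_quads[OF le, symmetric]
    by (rule sum.cong) (auto simp: B_def quads_def entry_def w_def)
  have Bu: "(\<Sum>(u, v)\<in>B (l1, l2) ?t id. w u v)
      = (\<Sum>j\<le>l2. fps_nth (g * h) (?m - j) * fps_nth (f * k) j)"
    unfolding sum_quads[OF le, symmetric]
    by (rule sum.reindex_bij_witness[where
          i = "\<lambda>((a, b), (c, d)). ((b, a), (c, d))" and j = "\<lambda>((a, b), (c, d)). ((b, a), (c, d))"])
       (auto simp: B_def quads_def entry_def w_def ac_simps)
  have Bv: "(\<Sum>(u, v)\<in>B (l1, l2) id ?t. w u v)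
      = (\<Sum>j\<le>l2. fps_nth (f * k) (?m - j) * fps_nth (g * h) j)"
    unfolding sum_quads[OF le, symmetric]
    by (rule sum.reindex_bij_witness[where
          i = "\<lambda>((a, b), (c, d)). ((a, b), (d, c))" and j = "\<lambda>((a, b), (c, d)). ((a, b), (d, c))"])
       (auto simp: B_def quads_def entry_def w_def ac_simps)
  have Buv: "(\<Sum>(u, v)\<in>B (l1, l2) ?t ?t. w u v)
      = (\<Sum>j\<le>l2. fps_nth (g * k) (?m - j) * fps_nth (f * h) j)"
    unfolding sum_quads[OF le, symmetric]
    by (rule sum.reindex_bij_witness[where
          i = "\<lambda>((a, b), (c, d)). ((b, a), (d, c))" and j = "\<lambda>((a, b), (c, d)). ((b, a), (d, c))"])
       (auto simp: B_def quads_def entry_def w_def ac_simps)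
  have "id \<noteq> ?t"
    by (metis id_apply one_eq_numeral_iff semiring_norm(85) transpose_apply_first)
  then show ?thesis
    by (simp add: S2_eq sign_swap_id B Bu Bv Buv del: One_nat_def)
qed

section \<open>Parity splitting of Q\<close>

text \<open>Indexing by $j = s - i$ makes the parity of the smaller index of each product visible.\<close>

lemma Q2_reversed:
  "Q2 x (r, s) = q2 x r * q2 x s + 2 * (\<Sum>j<s. (-1) ^ (s - j) * q2 x (r + s - j) * q2 x j)"
proof -
  have "(\<Sum>i=1..s. (-1) ^ i * q2 x (r + i) * q2 x (s - i))
      = (\<Sum>j<s. (-1) ^ (s - j) * q2 x (r + s - j) * q2 x j)"
    by (rule sum.reindex_bij_witness[where i = "\<lambda>j. s - j" and j = "\<lambda>i. s - i"]) auto
  then show ?thesis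
    by (simp add: Q2_def)
qed

text \<open>For odd $j$ the factors in \<open>Q2_reversed\<close> are coefficients of $E O$, for even $j$ they are
  coefficients of $O^2$, except that $j = 0$ contributes $q_0(x,x) = 1$. The relation
  $E^2 = 1 + T\,O^2$ turns each of the two mixed sums into the common sum \<open>T\<close> plus one boundary
  term.\<close>

lemma Q2_even_even:
  fixes x :: "nat \<Rightarrow> 'a::comm_ring_1"
  shows "Q2 x (2 * l1 + 4, 2 * l2 + 2) =
     4 * ((\<Sum>j\<le>l2. q_ee x (l1 + l2 + 2 - j) * q_oo x j) + (\<Sum>j\<le>l2. q_oo x (l1 + l2 + 2 - j) * q_ee x j)
        - 2 * (\<Sum>j\<le>l2. q_eo x (l1 + l2 + 2 - j) * q_eo x j))"
proof -
  define T where "T = (\<Sum>j<l2. q_oo x (l1 + l2 + 1 - j) * q_oo x j)"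
  have eo: "(\<Sum>j<Suc l2. q2 x (2 * l1 + 4 + 2 * Suc l2 - Suc (2 * j)) * q2 x (Suc (2 * j)))
      = 4 * (\<Sum>j\<le>l2. q_eo x (l1 + l2 + 2 - j) * q_eo x j)"
  proof -
    have "2 * l1 + 4 + 2 * Suc l2 - Suc (2 * j) = Suc (2 * (l1 + l2 + 2 - j))" if "j \<le> l2" for j
      using that by simp
    then show ?thesis
      by (simp add: lessThan_Suc_atMost sum_distrib_left q2_odd del: sum.lessThan_Suc mult_Suc_right)
  qed
  have even: "(\<Sum>j<Suc l2. q2 x (2 * l1 + 4 + 2 * Suc l2 - 2 * j) * q2 x (2 * j))
      = 2 * q_oo x (l1 + l2 + 2) + 4 * T"
  proof -
    have first: "q2 x (2 * l1 + 4 + 2 * Suc l2 - 2 * 0) = 2 * q_oo x (l1 + l2 + 2)"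
      unfolding q2_even[symmetric] by (rule arg_cong[where f = "q2 x"]) simp
    have "2 * l1 + 4 + 2 * Suc l2 - 2 * Suc j = Suc (Suc (2 * (l1 + l2 + 1 - j)))" if "j < l2" for j
      using that by simp
    then have rest: "q2 x (2 * l1 + 4 + 2 * Suc l2 - 2 * Suc j) * q2 x (2 * Suc j)
        = 4 * (q_oo x (l1 + l2 + 1 - j) * q_oo x j)" if "j < l2" for j
      using that q2_even[of x j] by (simp only: q2_even mult_Suc_right add_2_eq_Suc) simp
    have "(\<Sum>j<l2. q2 x (2 * l1 + 4 + 2 * Suc l2 - 2 * Suc j) * q2 x (2 * Suc j)) = 4 * T"
      unfolding T_def sum_distrib_left by (intro sum.cong refl) (simp only: rest lessThan_iff)
    then show ?thesis
      by (simp only: sum.lessThan_Suc_shift first) (simp add: q2_0)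
  qed
  have "Q2 x (2 * l1 + 4, 2 * Suc l2) = q2 x (2 * l1 + 4) * q2 x (2 * Suc l2)
      + 2 * ((2 * q_oo x (l1 + l2 + 2) + 4 * T) - 4 * (\<Sum>j\<le>l2. q_eo x (l1 + l2 + 2 - j) * q_eo x j))"
  proof -
    have "(-1 :: 'a) ^ (2 * Suc l2 - 2 * j) = 1" "(-1 :: 'a) ^ (2 * Suc l2 - Suc (2 * j)) = -1"
      if "j < Suc l2" for j
      using that by (simp_all add: Suc_diff_le minus_one_power_iff)
    then show ?thesis
      unfolding Q2_reversed sum_lessThan_double even[symmetric] eo[symmetric]
      by (simp add: sum_negf del: mult_Suc_right sum.lessThan_Suc)
  qed
  moreover have "q2 x (2 * l1 + 4) = 2 * q_oo x (l1 + 1)" "q2 x (2 * Suc l2) = 2 * q_oo x l2"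
    using q2_even[of x "l1 + 1"] q2_even[of x l2] by (simp_all add: eval_nat_numeral)
  moreover have "(\<Sum>j\<le>l2. q_ee x (l1 + l2 + 2 - j) * q_oo x j) = T + q_oo x (l1 + 1) * q_oo x l2"
  proof -
    have "q_ee x (l1 + l2 + 2 - j) = q_oo x (l1 + l2 + 1 - j)" if "j \<le> l2" for j
      using q_ee_Suc[of x "l1 + l2 + 1 - j"] that by (simp add: Suc_diff_le)
    then show ?thesis
      by (simp add: T_def flip: lessThan_Suc_atMost)
  qed
  moreover have "(\<Sum>j\<le>l2. q_oo x (l1 + l2 + 2 - j) * q_ee x j) = q_oo x (l1 + l2 + 2) + T"
    unfolding lessThan_Suc_atMost[symmetric] sum.lessThan_Suc_shift T_def q_ee_0 q_ee_Suc by simp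
  ultimately show ?thesis
    by (simp add: algebra_simps)
qed

text \<open>As before, odd $j$ gives $E O$ and even $j$ gives $O^2$, but with the signs exchanged. The
  product of the two \<open>q2\<close> in front of the sum is now the $j = l_2$ term for $E O$, with half
  the weight of the terms inside the sum; hence the two $E O$ sums with different upper limits.\<close>

lemma Q2_odd_odd:
  fixes x :: "nat \<Rightarrow> 'a::comm_ring_1"
  shows "Q2 x (2 * l1 + 3, 2 * l2 + 1) =
     4 * ((\<Sum>j\<le>l2. q_eo x (l1 + l2 + 1 - j) * q_eo x j) + (\<Sum>j<l2. q_eo x (l1 + l2 + 1 - j) * q_eo x j)
        - q_oo x (l1 + l2 + 1) - 2 * (\<Sum>j<l2. q_oo x (l1 + l2 - j) * q_oo x j))"
proof -
  define T where "T = (\<Sum>j<l2. q_oo x (l1 + l2 - j) * q_oo x j)"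
  define D where "D = (\<Sum>j<l2. q_eo x (l1 + l2 + 1 - j) * q_eo x j)"
  let ?N = "2 * l1 + 3 + Suc (2 * l2)"
  have eo: "(\<Sum>j<l2. q2 x (?N - Suc (2 * j)) * q2 x (Suc (2 * j))) = 4 * D"
  proof -
    have "?N - Suc (2 * j) = Suc (2 * (l1 + l2 + 1 - j))" if "j < l2" for j
      using that by simp
    then show ?thesis
      unfolding D_def
      by (simp add: sum_distrib_left q2_odd del: mult_Suc_right)
  qed
  have even: "(\<Sum>j<Suc l2. q2 x (?N - 2 * j) * q2 x (2 * j)) = 2 * q_oo x (l1 + l2 + 1) + 4 * T"
  proof -
    have first: "q2 x (?N - 2 * 0) = 2 * q_oo x (l1 + l2 + 1)"
      unfolding q2_even[symmetric] by (rule arg_cong[where f = "q2 x"]) simp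
    have "?N - 2 * Suc j = Suc (Suc (2 * (l1 + l2 - j)))" if "j < l2" for j
      using that by simp
    then have rest: "q2 x (?N - 2 * Suc j) * q2 x (2 * Suc j)
        = 4 * (q_oo x (l1 + l2 - j) * q_oo x j)" if "j < l2" for j
      using that q2_even[of x j] by (simp only: q2_even mult_Suc_right add_2_eq_Suc) simp
    have "(\<Sum>j<l2. q2 x (?N - 2 * Suc j) * q2 x (2 * Suc j)) = 4 * T"
      unfolding T_def sum_distrib_left by (intro sum.cong refl) (simp only: rest lessThan_iff)
    then show ?thesis
      by (simp only: sum.lessThan_Suc_shift first) (simp add: q2_0)
  qed
  have "Q2 x (2 * l1 + 3, Suc (2 * l2)) = q2 x (2 * l1 + 3) * q2 x (Suc (2 * l2))
      + 2 * (4 * D - (2 * q_oo x (l1 + l2 + 1) + 4 * T))"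
  proof -
    have "(-1 :: 'a) ^ (Suc (2 * l2) - 2 * j) = -1" if "j < Suc l2" for j
      using that by (simp add: Suc_diff_le minus_one_power_iff)
    moreover have "(-1 :: 'a) ^ (Suc (2 * l2) - Suc (2 * j)) = 1" for j
      by (simp add: minus_one_power_iff)
    ultimately show ?thesis
      unfolding Q2_reversed sum.lessThan_Suc sum_lessThan_double even[symmetric] eo[symmetric]
      by (simp add: sum_negf)
  qed
  moreover have "q2 x (2 * l1 + 3) = 2 * q_eo x (l1 + 1)" "q2 x (Suc (2 * l2)) = 2 * q_eo x l2"
    using q2_odd[of x "l1 + 1"] q2_odd[of x l2] by (simp_all add: eval_nat_numeral)
  moreover have "(\<Sum>j\<le>l2. q_eo x (l1 + l2 + 1 - j) * q_eo x j) = D + q_eo x (l1 + 1) * q_eo x l2"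
    by (simp add: D_def flip: lessThan_Suc_atMost)
  ultimately show ?thesis
    unfolding T_def[symmetric] D_def[symmetric] by (simp add: algebra_simps)
qed

theorem proposition5p3:
  fixes x :: "nat \<Rightarrow> 'a::comm_ring_1 poly poly" and lam :: "nat \<times> nat"
  assumes "x = indet" and "lam \<in> partitions2"
  shows "Q2 x (scale 2 lam + scale 2 Delta) =
           4 * (\<Sum>\<sigma>1\<in>S2. \<Sum>\<sigma>2\<in>S2. of_int (sign \<sigma>1) * of_int (sign \<sigma>2) *
                 (\<Sum>(u, v)\<in>B lam \<sigma>1 \<sigma>2.
                    q x (2 * int (entry u 1)) * q x (2 * int (entry u 2) + 1) *
                    q x (2 * int (entry v 1)) * q x (2 * int (entry v 2) + 1)))
         \<and> Q2 x (scale 2 lam + Delta + delta) =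
           4 * (\<Sum>\<sigma>1\<in>S2. \<Sum>\<sigma>2\<in>S2. of_int (sign \<sigma>1) * of_int (sign \<sigma>2) *
                 (\<Sum>(u, v)\<in>B lam \<sigma>1 \<sigma>2.
                    q x (2 * int (entry u 1)) * q x (2 * int (entry u 2) + 1) *
                    q x (2 * int (entry v 1) - 1) * q x (2 * int (entry v 2))))"
proof -
  obtain l1 l2 where lam: "lam = (l1, l2)"
    by (cases lam)
  let ?E = "even_part (q_series x)" and ?O = "odd_part (q_series x)"
  have first_index: "scale 2 lam + scale 2 Delta = (2 * l1 + 4, 2 * l2 + 2)"
    and second_index: "scale 2 lam + Delta + delta = (2 * l1 + 3, 2 * l2 + 1)"
    by (simp_all add: lam scale_def Delta_def delta_def)
  \<comment> \<open>In the second identity each of the four convolutions has one factor multiplied by the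
    indeterminate. This shifts that factor by one place, which either lowers the index $m - j$ or
    removes the term $j = 0$ and shifts $j$; with $E^2 = 1 + T\,O^2$ for the coefficients of $E^2$,
    this gives the sums of \<open>Q2_odd_odd\<close>.\<close>
  have XEO: "fps_nth (?E * (fps_X * ?O)) k = (if k = 0 then 0 else q_eo x (k - 1))"
    and XOO: "fps_nth (?O * (fps_X * ?O)) k = (if k = 0 then 0 else q_oo x (k - 1))" for k
    by (simp_all add: mult.left_commute[of _ fps_X])
  have EO1: "(\<Sum>j\<le>l2. fps_nth (?E * (fps_X * ?O)) (l1 + l2 + 2 - j) * fps_nth (?O * ?E) j)
      = (\<Sum>j\<le>l2. q_eo x (l1 + l2 + 1 - j) * q_eo x j)"
    by (rule sum.cong) (auto simp: XEO mult.commute[of ?O ?E] Suc_diff_le)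
  have EO2: "(\<Sum>j\<le>l2. fps_nth (?O * ?E) (l1 + l2 + 2 - j) * fps_nth (?E * (fps_X * ?O)) j)
      = (\<Sum>j<l2. q_eo x (l1 + l2 + 1 - j) * q_eo x j)"
    unfolding lessThan_Suc_atMost[symmetric] sum.lessThan_Suc_shift XEO
    by (simp add: mult.commute[of ?O ?E])
  have OO1: "(\<Sum>j\<le>l2. fps_nth (?O * (fps_X * ?O)) (l1 + l2 + 2 - j) * q_ee x j)
      = q_oo x (l1 + l2 + 1) + (\<Sum>j<l2. q_oo x (l1 + l2 - j) * q_oo x j)"
    unfolding lessThan_Suc_atMost[symmetric] sum.lessThan_Suc_shift XOO q_ee_0 q_ee_Suc
    by simp
  have OO2: "(\<Sum>j\<le>l2. q_ee x (l1 + l2 + 2 - j) * fps_nth (?O * (fps_X * ?O)) j)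
      = (\<Sum>j<l2. q_oo x (l1 + l2 - j) * q_oo x j)"
  proof -
    have "q_ee x (l1 + l2 + 1 - j) = q_oo x (l1 + l2 - j)" if "j < l2" for j
      using q_ee_Suc[of x "l1 + l2 - j"] that by (simp add: Suc_diff_le)
    then show ?thesis
      unfolding lessThan_Suc_atMost[symmetric] sum.lessThan_Suc_shift XOO by simp
  qed
  \<comment> \<open>The series $(f, g, h, k)$ of \<open>signed_sum_B\<close> are $(E, O, E, O)$ for the first identity and
    $(E, O, T\,O, E)$ for the second.\<close>
  show ?thesis
    unfolding first_index second_index
    unfolding lam q_even q_odd q_odd_shifted signed_sum_B Q2_even_even Q2_odd_odd
      EO1 EO2 OO1 OO2
    unfolding mult.commute[of ?O ?E]
    by (simp add: algebra_simps)
qed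

end
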